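(* The measure $M$ is neither subadditive, nor superadditive, nor weakly additive. That is: (1) The inequality $M_{\rm AC|BD}(\rho^{\rm AB}\otimes\sigma^{\rm CD})\le M_{\rm A|B}(\rho^{\rm AB})+M_{\rm C|D}(\sigma^{\rm CD})$ does not hold for all pairs of bipartite density matrices $\rho^{\rm AB}$, $\sigma^{\rm CD}$ on finite-dimensional spaces. (2) The inequality $M_{\rm AC|BD}(\rho^{\rm AB}\otimes\sigma^{\rm CD})\ge M_{\rm A|B}(\rho^{\rm AB})+M_{\rm C|D}(\sigma^{\rm CD})$ does not hold for all pairs of bipartite density matrices $\rho^{\rm AB}$, $\sigma^{\rm CD}$ on finite-dimensional spaces. (3) The equality $M_{\rm AA\cdots|BB\cdots}\bigl((\rho^{\rm AB})^{\otimes m}\bigr)=m\,M_{\rm A|B}(\rho^{\rm AB})$ does not hold for all bipartite density matrices $\rho^{\rm AB}$ on finite-dimensional spaces and all positive integers $m$.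
   Context: A density matrix is a positive semidefinite Hermitian matrix of trace one. The subscript on $M$ denotes the bipartite splitting with respect to which $M$ is computed: $M_{\rm A|B}$ regards the state as bipartite with parts ${\rm A}$ and ${\rm B}$; $M_{\rm AC|BD}$ regards a state on $\mathcal H^{\rm A}\otimes\mathcal H^{\rm B}\otimes\mathcal H^{\rm C}\otimes\mathcal H^{\rm D}$ as bipartite with first part $\mathcal H^{\rm A}\otimes\mathcal H^{\rm C}$ and second part $\mathcal H^{\rm B}\otimes\mathcal H^{\rm D}$; $M_{\rm AA\cdots|BB\cdots}$ regards a state on $(\mathcal H^{\rm A}\otimes\mathcal H^{\rm B})^{\otimes m}$ as bipartite with the $m$ copies of $\mathcal H^{\rm A}$ as first part and the $m$ copies of $\mathcal H^{\rm B}$ as second part. Definition of $M=M_{\rm A|B}$ for a density matrix $\rho^{\rm AB}$ on a finite-dimensional $\mathcal H^{\rm A}\otimes\mathcal H^{\rm B}$. For $x,y\ge0$ let ${\rm nim}_y(x)$ be the nearest integer multiple of $y$ to $x$, ties rounded down: ${\rm nim}_0(x)=0$, and for $y\neq0$, ${\rm nim}_y(x)=y\lfloor x/y\rfloor$ if $x-y\lfloor x/y\rfloor\le y\lceil x/y\rceil-x$, and ${\rm nim}_y(x)=y\lceil x/y\rceil$ otherwise. Let $\eta_1,\dots,\eta_n$ be the distinct eigenvalues of $\rho^{\rm AB}$, let $d^{\eta_j}$ be the dimension of the $\eta_j$-eigenspace, and let $\tilde\rho^{\eta_j}$ be $\eta_j$ times the orthogonal projector onto the $\eta_j$-eigenspace,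 so $\rho^{\rm AB}=\sum_j\tilde\rho^{\eta_j}$. Let $\lambda_i^{j,{\rm A}}$, $i=1,\dots,d_j^{\rm A}$, be the nonzero eigenvalues, with multiplicity, of ${\rm Tr}_{\rm B}\tilde\rho^{\eta_j}$, where $d_j^{\rm A}$ is its rank (an eigenvalue $\eta_j=0$ contributes an empty sum). Define $$M^{\rm A}(\rho^{\rm AB})=-\sum_{j=1}^n\sum_{i=1}^{d_j^{\rm A}}\left|\lambda_i^{j,{\rm A}}-{\rm nim}_{\eta_j}(\lambda_i^{j,{\rm A}})\right|\log_2\frac{\lambda_i^{j,{\rm A}}}{\eta_jd^{\eta_j}}.$$ $M^{\rm B}(\rho^{\rm AB})$ is defined in the same way using the nonzero eigenvalues $\lambda_i^{j,{\rm B}}$ of ${\rm Tr}_{\rm A}\tilde\rho^{\eta_j}$. Finally $M(\rho^{\rm AB})=\frac12[M^{\rm A}(\rho^{\rm AB})+M^{\rm B}(\rho^{\rm AB})]$. *)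

theory Defs
  imports
    "HOL-Computational_Algebra.Computational_Algebra"
    "Jordan_Normal_Form.Char_Poly"
    "Jordan_Normal_Form.Matrix_Kernel"
    "Jordan_Normal_Form.Schur_Decomposition"
    "Jordan_Normal_Form.Spectral_Radius"
begin

text \<open>
  Operators on a tensor product of spaces of dimensions \<open>d\<close> and \<open>e\<close> are matrices of size \<open>d * e\<close>;
  the basis vector \<open>|a> \<otimes> |b>\<close> has index \<open>a * e + b\<close> (\<open>a < d\<close>, \<open>b < e\<close>), i.e. the
  rightmost tensor factor varies fastest.
\<close>

definition hermitian :: "complex mat \<Rightarrow> bool" where
  "hermitian A \<longleftrightarrow> mat_adjoint A = A"

definition positive_semidefinite :: "nat \<Rightarrow> complex mat \<Rightarrow> bool" where
  "positive_semidefinite n A \<longleftrightarrow> (\<forall>v\<in>carrier_vec n. 0 \<le> Re ((A *\<^sub>v v) \<bullet>c v))"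

definition mat_trace :: "complex mat \<Rightarrow> complex" where
  "mat_trace A = (\<Sum>i<dim_row A. A $$ (i, i))"

definition density_matrix :: "nat \<Rightarrow> complex mat \<Rightarrow> bool" where
  "density_matrix n \<rho> \<longleftrightarrow>
     \<rho> \<in> carrier_mat n n \<and> hermitian \<rho> \<and> positive_semidefinite n \<rho> \<and> mat_trace \<rho> = 1"

text \<open>Partial traces over the second and over the first of two tensor factors.\<close>

definition ptrace_snd :: "nat \<Rightarrow> nat \<Rightarrow> complex mat \<Rightarrow> complex mat" where
  "ptrace_snd dA dB X = mat dA dA (\<lambda>(a, a'). \<Sum>b<dB. X $$ (a * dB + b, a' * dB + b))"

definition ptrace_fst :: "nat \<Rightarrow> nat \<Rightarrow> complex mat \<Rightarrow> complex mat" where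
  "ptrace_fst dA dB X = mat dB dB (\<lambda>(b, b'). \<Sum>a<dA. X $$ (a * dB + b, a * dB + b'))"

definition nim :: "real \<Rightarrow> real \<Rightarrow> real" where
  "nim y x =
     (if y = 0 then 0
      else if x - y * \<lfloor>x / y\<rfloor> \<le> y * \<lceil>x / y\<rceil> - x then y * \<lfloor>x / y\<rfloor>
      else y * \<lceil>x / y\<rceil>)"

definition eigenspace :: "complex mat \<Rightarrow> complex \<Rightarrow> complex vec set" where
  "eigenspace A \<eta> = mat_kernel (char_matrix A \<eta>)"

definition eigenspace_dim :: "complex mat \<Rightarrow> complex \<Rightarrow> nat" where
  "eigenspace_dim A \<eta> = kernel_dim (char_matrix A \<eta>)"

definition is_orth_projector :: "nat \<Rightarrow> complex vec set \<Rightarrow> complex mat \<Rightarrow> bool" where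
  "is_orth_projector n S P \<longleftrightarrow>
     P \<in> carrier_mat n n \<and> hermitian P \<and> P * P = P \<and> (\<lambda>v. P *\<^sub>v v) ` carrier_vec n = S"

text \<open>The orthogonal projector onto a linear subspace of \<open>carrier_vec n\<close> exists and is unique.\<close>

definition orth_projector :: "nat \<Rightarrow> complex vec set \<Rightarrow> complex mat" where
  "orth_projector n S = (THE P. is_orth_projector n S P)"

definition spectral_part :: "complex mat \<Rightarrow> complex \<Rightarrow> complex mat" where
  "spectral_part \<rho> \<eta> = \<eta> \<cdot>\<^sub>m orth_projector (dim_row \<rho>) (eigenspace \<rho> \<eta>)"

definition nonzero_eigenvalues :: "complex mat \<Rightarrow> complex multiset" where
  "nonzero_eigenvalues A = {#\<mu> \<in># proots (char_poly A). \<mu> \<noteq> 0#}"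

text \<open>
  The argument \<open>Tr\<close> is the partial trace onto the part in question. All eigenvalues occurring are
  those of Hermitian matrices, hence real, and \<open>Re\<close> is merely a type conversion.
\<close>

definition M_part :: "(complex mat \<Rightarrow> complex mat) \<Rightarrow> complex mat \<Rightarrow> real" where
  "M_part Tr \<rho> =
     - (\<Sum>\<eta>\<in>spectrum \<rho>. \<Sum>\<mu>\<in>#nonzero_eigenvalues (Tr (spectral_part \<rho> \<eta>)).
          \<bar>Re \<mu> - nim (Re \<eta>) (Re \<mu>)\<bar> *
          log 2 (Re \<mu> / (Re \<eta> * real (eigenspace_dim \<rho> \<eta>))))"

definition M_A :: "nat \<Rightarrow> nat \<Rightarrow> complex mat \<Rightarrow> real" where
  "M_A dA dB = M_part (ptrace_snd dA dB)"

definition M_B :: "nat \<Rightarrow> nat \<Rightarrow> complex mat \<Rightarrow> real" where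
  "M_B dA dB = M_part (ptrace_fst dA dB)"

definition M :: "nat \<Rightarrow> nat \<Rightarrow> complex mat \<Rightarrow> real" where
  "M dA dB \<rho> = (M_A dA dB \<rho> + M_B dA dB \<rho>) / 2"

definition tensor_mat :: "complex mat \<Rightarrow> complex mat \<Rightarrow> complex mat" where
  "tensor_mat A B =
     mat (dim_row A * dim_row B) (dim_col A * dim_col B)
       (\<lambda>(i, j). A $$ (i div dim_row B, j div dim_col B) * B $$ (i mod dim_row B, j mod dim_col B))"

fun tensor_pow :: "complex mat \<Rightarrow> nat \<Rightarrow> complex mat" where
  "tensor_pow A 0 = 1\<^sub>m 1"
| "tensor_pow A (Suc m) = tensor_mat A (tensor_pow A m)"

definition reindex :: "(nat \<Rightarrow> nat) \<Rightarrow> complex mat \<Rightarrow> complex mat" where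
  "reindex f A = mat (dim_row A) (dim_col A) (\<lambda>(i, j). A $$ (f i, f j))"

text \<open>
  Reordering of tensor factors. \<open>ACBD_index\<close> maps the index of \<open>|a>|c>|b>|d>\<close> in
  \<open>A \<otimes> C \<otimes> B \<otimes> D\<close> to the index of \<open>|a>|b>|c>|d>\<close> in \<open>A \<otimes> B \<otimes> C \<otimes> D\<close>.
\<close>

definition ACBD_index :: "nat \<Rightarrow> nat \<Rightarrow> nat \<Rightarrow> nat \<Rightarrow> nat \<Rightarrow> nat" where
  "ACBD_index dA dB dC dD p =
     (let x = p div (dB * dD); y = p mod (dB * dD);
          a = x div dC; c = x mod dC; b = y div dD; d = y mod dD
      in (a * dB + b) * (dC * dD) + (c * dD + d))"

definition M_AC_BD :: "nat \<Rightarrow> nat \<Rightarrow> nat \<Rightarrow> nat \<Rightarrow> complex mat \<Rightarrow> real" where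
  "M_AC_BD dA dB dC dD \<tau> = M (dA * dC) (dB * dD) (reindex (ACBD_index dA dB dC dD) \<tau>)"

text \<open>
  \<open>copies_index\<close> maps the index of \<open>|a\<^sub>1 \<dots> a\<^sub>m>|b\<^sub>1 \<dots> b\<^sub>m>\<close> in the \<open>m\<close> copies of \<open>A\<close> followed by
  the \<open>m\<close> copies of \<open>B\<close> to the index of \<open>|a\<^sub>1 b\<^sub>1 \<dots> a\<^sub>m b\<^sub>m>\<close> in the \<open>m\<close>-th tensor power of
  \<open>A \<otimes> B\<close>; the \<open>k\<close>-th digit of an index belongs to the \<open>(m - k)\<close>-th copy.
\<close>

definition copies_index :: "nat \<Rightarrow> nat \<Rightarrow> nat \<Rightarrow> nat \<Rightarrow> nat" where
  "copies_index dA dB m p =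
     (let a = p div dB ^ m; b = p mod dB ^ m
      in \<Sum>k<m. (a div dA ^ k mod dA * dB + b div dB ^ k mod dB) * (dA * dB) ^ k)"

definition M_copies :: "nat \<Rightarrow> nat \<Rightarrow> nat \<Rightarrow> complex mat \<Rightarrow> real" where
  "M_copies dA dB m \<tau> = M (dA ^ m) (dB ^ m) (reindex (copies_index dA dB m) \<tau>)"

end

theory Submission
  imports Defs
begin

text \<open>
  For pure states \<open>\<eta> = 1\<close> is the only relevant eigenvalue, and \<open>M\<close> is the sum of
  \<open>- min \<lambda> (1 - \<lambda>) * log 2 \<lambda>\<close> over the squared Schmidt coefficients \<open>\<lambda>\<close>. For the coefficients
  \<open>9 / 25\<close> and \<open>16 / 25\<close> the larger one enters with weight \<open>9 / 25\<close>, whereas all coefficients of two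
  copies lie below \<open>1 / 2\<close> and enter with their full weight; so two copies have more than twice the
  value of one, which refutes subadditivity and weak additivity.

  Superadditivity fails for a Bell state (\<open>M = 1\<close>) and the maximally mixed state of two qubits: the
  nonzero eigenvalue of the product is \<open>\<eta> = 1 / 4\<close>, and both marginals have all eigenvalues equal to
  \<open>1 / 4\<close>, a multiple of \<open>\<eta>\<close>, so that \<open>M\<close> vanishes.
\<close>

section \<open>Adjoints, orthogonal projectors and eigenspaces\<close>

lemma mat_adjoint_dim [simp]:
  "dim_row (mat_adjoint A) = dim_col A" "dim_col (mat_adjoint A) = dim_row A"
  by (simp_all add: mat_adjoint_def)

lemma mat_adjoint_index [simp]:
  "i < dim_col A \<Longrightarrow> j < dim_row A \<Longrightarrow> mat_adjoint A $$ (i, j) = conjugate (A $$ (j, i))"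
  by (simp add: mat_adjoint_def mat_of_rows_index)

lemma mult_mat_unit_vec:
  fixes A :: "complex mat"
  assumes "A \<in> carrier_mat n m" "j < m"
  shows "A *\<^sub>v unit_vec m j = col A j"
  by (rule eq_vecI) (use assms in auto)

lemma smult_mat_mult_vec:
  fixes A :: "complex mat"
  assumes "A \<in> carrier_mat n m" "v \<in> carrier_vec m"
  shows "(c \<cdot>\<^sub>m A) *\<^sub>v v = c \<cdot>\<^sub>v (A *\<^sub>v v)"
  by (rule eq_vecI) (use assms in auto)

lemma mat_adjoint_mult:
  fixes A B :: "complex mat"
  assumes "A \<in> carrier_mat n m" "B \<in> carrier_mat m k"
  shows "mat_adjoint (A * B) = mat_adjoint B * mat_adjoint A"
  by (rule eq_matI, insert assms) (auto simp: scalar_prod_def mult.commute)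

text \<open>Every column of \<open>Q\<close> lies in \<open>S\<close>, the range of
  \<open>P\<close>, and an idempotent fixes its range, so \<open>P * Q = Q\<close>. By symmetry
  \<open>Q * P = P\<close>, and taking adjoints turns this into \<open>P * Q = P\<close>.\<close>

lemma is_orth_projector_unique:
  assumes "is_orth_projector n S P" "is_orth_projector n S Q"
  shows "P = Q"
proof -
  have *: "P * Q = Q" if P: "is_orth_projector n S P" and Q: "is_orth_projector n S Q" for P Q
  proof (rule eq_matI)
    have c: "P \<in> carrier_mat n n" "Q \<in> carrier_mat n n"
      using P Q by (auto simp: is_orth_projector_def)
    fix i j assume "i < dim_row Q" "j < dim_col Q"
    hence ij: "i < n" "j < n" using c by auto
    have "Q *\<^sub>v unit_vec n j \<in> S" using Q by (auto simp: is_orth_projector_def)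
    then obtain v where v: "v \<in> carrier_vec n" "Q *\<^sub>v unit_vec n j = P *\<^sub>v v"
      using P by (auto simp: is_orth_projector_def)
    have "(P * Q) *\<^sub>v unit_vec n j = P *\<^sub>v (P *\<^sub>v v)"
      using c v by (simp add: assoc_mult_mat_vec[of P n n Q n])
    also have "\<dots> = (P * P) *\<^sub>v v"
      using c v by (simp add: assoc_mult_mat_vec[of P n n P n])
    also have "\<dots> = Q *\<^sub>v unit_vec n j"
      using P v by (simp add: is_orth_projector_def)
    finally have "col (P * Q) j = col Q j"
      using c ij by (simp add: mult_mat_unit_vec[of _ n n])
    thus "(P * Q) $$ (i, j) = Q $$ (i, j)"
      using c ij by (metis index_col carrier_matD index_mult_mat(2,3))
  qed (use P Q in \<open>auto simp: is_orth_projector_def\<close>)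
  have c: "P \<in> carrier_mat n n" "Q \<in> carrier_mat n n"
    and h: "mat_adjoint P = P" "mat_adjoint Q = Q"
    using assms by (auto simp: is_orth_projector_def hermitian_def)
  have "P = mat_adjoint (Q * P)" using *[OF assms(2,1)] h by simp
  also have "\<dots> = P * Q" using mat_adjoint_mult[OF c(2,1)] h by simp
  also have "\<dots> = Q" using *[OF assms] .
  finally show ?thesis .
qed

text \<open>Evaluates the definite description: any matrix that passes the projector conditions for
  \<open>S\<close> is its value.\<close>

lemma orth_projector_eq: "is_orth_projector n S P \<Longrightarrow> orth_projector n S = P"
  unfolding orth_projector_def using is_orth_projector_unique by blast

lemma eigenspace_eq:
  assumes "A \<in> carrier_mat n n"
  shows "eigenspace A \<eta> = {v \<in> carrier_vec n. A *\<^sub>v v = \<eta> \<cdot>\<^sub>v v}"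
proof -
  have "char_matrix A \<eta> *\<^sub>v v = 0\<^sub>v n \<longleftrightarrow> A *\<^sub>v v = \<eta> \<cdot>\<^sub>v v" if v: "v \<in> carrier_vec n" for v
  proof -
    have "char_matrix A \<eta> *\<^sub>v v = A *\<^sub>v v + (- \<eta>) \<cdot>\<^sub>v v"
      using assms v
      by (auto simp: char_matrix_def add_mult_distrib_mat_vec[of _ n n] smult_mat_mult_vec[of _ n n])
    thus ?thesis using assms v by (auto simp: vec_eq_iff)
  qed
  thus ?thesis
    using assms by (auto simp: eigenspace_def mat_kernel[of _ n n])
qed

lemma cscalar_prod_adjoint:
  fixes A :: "complex mat"
  assumes "A \<in> carrier_mat n n" "u \<in> carrier_vec n" "v \<in> carrier_vec n"
  shows "(A *\<^sub>v u) \<bullet>c v = u \<bullet>c (mat_adjoint A *\<^sub>v v)"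
proof -
  have "(A *\<^sub>v u) \<bullet>c v = (\<Sum>i<n. \<Sum>j<n. A $$ (i, j) * u $ j * cnj (v $ i))"
    using assms by (auto simp: scalar_prod_def atLeast0LessThan sum_distrib_right)
  also have "\<dots> = (\<Sum>j<n. \<Sum>i<n. A $$ (i, j) * u $ j * cnj (v $ i))"
    by (rule sum.swap)
  also have "\<dots> = u \<bullet>c (mat_adjoint A *\<^sub>v v)"
    using assms by (auto simp: scalar_prod_def atLeast0LessThan sum_distrib_left mult_ac intro!: sum.cong)
  finally show ?thesis .
qed

section \<open>Spectral data of a scaled projector\<close>

text \<open>All states considered below are, after reindexing, scalar multiples of an orthogonal
  projector, so their spectral decomposition can be given in closed form without diagonalising
  anything.\<close>

locale projector =
  fixes n :: nat and P :: "complex mat"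
  assumes carrier [simp]: "P \<in> carrier_mat n n"
    and hermitian: "hermitian P"
    and idem: "P * P = P"
begin

lemma dim [simp]: "dim_row P = n" "dim_col P = n"
  using carrier_matD[OF carrier] by auto

lemma adjoint: "mat_adjoint P = P"
  using hermitian by (simp add: hermitian_def)

lemma idem_vec: "v \<in> carrier_vec n \<Longrightarrow> P *\<^sub>v (P *\<^sub>v v) = P *\<^sub>v v"
  using assoc_mult_mat_vec[OF carrier carrier] idem by simp

lemma smult_mult_vec: "v \<in> carrier_vec n \<Longrightarrow> (\<eta> \<cdot>\<^sub>m P) *\<^sub>v v = \<eta> \<cdot>\<^sub>v (P *\<^sub>v v)"
  using carrier by (simp add: smult_mat_mult_vec[of _ n n])

lemma eigenspace_smult:
  assumes "\<eta> \<noteq> 0"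
  shows "eigenspace (\<eta> \<cdot>\<^sub>m P) \<eta> = {v \<in> carrier_vec n. P *\<^sub>v v = v}"
proof -
  have "\<eta> \<cdot>\<^sub>v a = \<eta> \<cdot>\<^sub>v b \<longleftrightarrow> a = b" for a b
    using assms by (auto simp: vec_eq_iff)
  thus ?thesis
    by (auto simp: eigenspace_eq[of _ n] smult_mult_vec)
qed

lemma eigenspace_smult_0:
  assumes "\<eta> \<noteq> 0"
  shows "eigenspace (\<eta> \<cdot>\<^sub>m P) 0 = {v \<in> carrier_vec n. P *\<^sub>v v = 0\<^sub>v n}"
proof -
  have "\<eta> \<cdot>\<^sub>v (P *\<^sub>v v) = 0 \<cdot>\<^sub>v v \<longleftrightarrow> P *\<^sub>v v = 0\<^sub>v n" if "v \<in> carrier_vec n" for v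
    using assms that carrier_matD[OF carrier] by (auto simp: vec_eq_iff simp del: index_mult_mat_vec)
  thus ?thesis
    by (auto simp: eigenspace_eq[of _ n] smult_mult_vec)
qed

text \<open>The range of an idempotent is its set of fixed vectors, and these form the
  \<eta>-eigenspace.\<close>

lemma spectral_part_smult:
  assumes "\<eta> \<noteq> 0"
  shows "spectral_part (\<eta> \<cdot>\<^sub>m P) \<eta> = \<eta> \<cdot>\<^sub>m P"
proof -
  have "(\<lambda>v. P *\<^sub>v v) ` carrier_vec n = {v \<in> carrier_vec n. P *\<^sub>v v = v}"
    by (auto simp: idem_vec mult_mat_vec_carrier[OF carrier] image_iff) metis
  hence "is_orth_projector n (eigenspace (\<eta> \<cdot>\<^sub>m P) \<eta>) P"
    by (simp add: is_orth_projector_def hermitian idem eigenspace_smult assms)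
  thus ?thesis
    using carrier by (simp add: spectral_part_def orth_projector_eq)
qed

text \<open>This is the projector onto the kernel of \<open>P\<close>, that is, onto the eigenspace
  for the eigenvalue 0.\<close>

lemma complement: "projector n (1\<^sub>m n - P)"
proof
  show "hermitian (1\<^sub>m n - P)"
  proof -
    have "conjugate (P $$ (j, i)) = P $$ (i, j)" if "i < n" "j < n" for i j
      using mat_adjoint_index[of i P j] that by (simp add: adjoint)
    thus ?thesis
      unfolding hermitian_def by (intro eq_matI) (use carrier in auto)
  qed
  show "(1\<^sub>m n - P) * (1\<^sub>m n - P) = 1\<^sub>m n - P"
  proof -
    have "(1\<^sub>m n - P) * (1\<^sub>m n - P) = 1\<^sub>m n * (1\<^sub>m n - P) - P * (1\<^sub>m n - P)"
      by (rule minus_mult_distrib_mat[of _ n n _ _ n]) (auto intro: minus_carrier_mat)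
    also have "P * (1\<^sub>m n - P) = P * 1\<^sub>m n - P * P"
      by (rule mult_minus_distrib_mat[of _ n n _ n]) auto
    also have "\<dots> = 0\<^sub>m n n" by (simp add: idem minus_r_inv_mat[OF carrier])
    also have "1\<^sub>m n * (1\<^sub>m n - P) - 0\<^sub>m n n = 1\<^sub>m n - P"
      by (rule eq_matI) auto
    finally show ?thesis .
  qed
qed (use carrier in auto)

text \<open>The factor 0 annihilates all entries, but the dimensions of the result are known only
  once the definite description has been evaluated, here to \<open>1\<^sub>m n - P\<close>.\<close>

lemma spectral_part_smult_0:
  assumes "\<eta> \<noteq> 0"
  shows "spectral_part (\<eta> \<cdot>\<^sub>m P) 0 = 0\<^sub>m n n"
proof -
  interpret Q: projector n "1\<^sub>m n - P" by (rule complement)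
  have "(1\<^sub>m n - P) *\<^sub>v v = v \<longleftrightarrow> P *\<^sub>v v = 0\<^sub>v n" if "v \<in> carrier_vec n" for v
  proof -
    have "(1\<^sub>m n - P) *\<^sub>v v = v - P *\<^sub>v v"
      using that by (simp add: minus_mult_distrib_mat_vec[of _ n n])
    thus ?thesis using that carrier_matD[OF carrier] by (auto simp: vec_eq_iff simp del: index_mult_mat_vec)
  qed
  moreover have "(\<lambda>v. (1\<^sub>m n - P) *\<^sub>v v) ` carrier_vec n = {v \<in> carrier_vec n. (1\<^sub>m n - P) *\<^sub>v v = v}"
    by (auto simp: Q.idem_vec mult_mat_vec_carrier[OF Q.carrier] image_iff) metis
  ultimately have "is_orth_projector n (eigenspace (\<eta> \<cdot>\<^sub>m P) 0) (1\<^sub>m n - P)"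
    using Q.carrier by (auto simp: is_orth_projector_def Q.hermitian Q.idem eigenspace_smult_0 assms)
  thus ?thesis
    using carrier by (auto simp: spectral_part_def orth_projector_eq)
qed

text \<open>Applying the scaled projector twice to an eigenvector \<open>v\<close> with eigenvalue
  \<open>e\<close> and using idempotence gives \<open>e * e = \<eta> * e\<close> on the nonzero
  entries of \<open>v\<close>.\<close>

lemma spectrum_smult:
  "spectrum (\<eta> \<cdot>\<^sub>m P) \<subseteq> {0, \<eta>}"
proof
  fix e assume "e \<in> spectrum (\<eta> \<cdot>\<^sub>m P)"
  then obtain v where v: "v \<in> carrier_vec n" "v \<noteq> 0\<^sub>v n" "\<eta> \<cdot>\<^sub>v (P *\<^sub>v v) = e \<cdot>\<^sub>v v"
    using carrier by (auto simp: spectrum_def eigenvalue_def eigenvector_def smult_mult_vec)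
  have "e \<cdot>\<^sub>v (e \<cdot>\<^sub>v v) = \<eta> \<cdot>\<^sub>v (e \<cdot>\<^sub>v (P *\<^sub>v v))"
    using v(3) by (metis smult_smult_assoc mult.commute)
  also have "e \<cdot>\<^sub>v (P *\<^sub>v v) = P *\<^sub>v (\<eta> \<cdot>\<^sub>v (P *\<^sub>v v))"
    using v by (simp add: mult_mat_vec[OF carrier])
  also have "\<dots> = \<eta> \<cdot>\<^sub>v (P *\<^sub>v v)"
    using mult_mat_vec[OF carrier mult_mat_vec_carrier[OF carrier v(1)]] v(1) by (simp only: idem_vec)
  also have "\<dots> = e \<cdot>\<^sub>v v" by (rule v(3))
  finally have *: "e * (e * v $ i) = \<eta> * (e * v $ i)" if "i < n" for i
    using that v(1) by (auto simp: vec_eq_iff)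
  obtain i where "i < n" "v $ i \<noteq> 0"
    using v(1,2) by (auto simp: vec_eq_iff)
  thus "e \<in> {0, \<eta>}" using *[of i] by auto
qed

text \<open>A nonzero column of \<open>P\<close> is fixed by \<open>P\<close> and would therefore be
  an eigenvector for \<eta>.\<close>

lemma zero_if_not_in_spectrum:
  assumes "\<eta> \<notin> spectrum (\<eta> \<cdot>\<^sub>m P)"
  shows "P = 0\<^sub>m n n"
proof (rule eq_matI)
  fix i j assume "i < dim_row (0\<^sub>m n n :: complex mat)" "j < dim_col (0\<^sub>m n n :: complex mat)"
  hence ij: "i < n" "j < n" by auto
  let ?v = "P *\<^sub>v unit_vec n j"
  have "?v = 0\<^sub>v n"
  proof (rule ccontr)
    assume "?v \<noteq> 0\<^sub>v n"
    hence "eigenvector (\<eta> \<cdot>\<^sub>m P) ?v \<eta>"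
      using carrier by (simp add: eigenvector_def smult_mult_vec idem_vec mult_mat_vec_carrier[OF carrier])
    thus False using assms by (auto simp: spectrum_def eigenvalue_def)
  qed
  thus "P $$ (i, j) = 0\<^sub>m n n $$ (i, j)"
    using ij carrier mult_mat_unit_vec[OF carrier, of j]
    by (metis carrier_matD index_col index_zero_mat(1) index_zero_vec(1))
qed (use carrier in auto)

text \<open>Only the eigenvalue \<eta> contributes: the spectral part for 0 is the zero matrix,
  whose image under \<open>Tr\<close> has no nonzero eigenvalues by \<open>Tr0\<close>.\<close>

lemma M_part_smult:
  assumes "\<eta> \<noteq> 0" and Tr0: "nonzero_eigenvalues (Tr (0\<^sub>m n n)) = {#}"
  shows "M_part Tr (\<eta> \<cdot>\<^sub>m P) =
    - (\<Sum>\<mu>\<in>#nonzero_eigenvalues (Tr (\<eta> \<cdot>\<^sub>m P)). \<bar>Re \<mu> - nim (Re \<eta>) (Re \<mu>)\<bar> *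
         log 2 (Re \<mu> / (Re \<eta> * real (eigenspace_dim (\<eta> \<cdot>\<^sub>m P) \<eta>))))"
    (is "_ = - ?s \<eta>")
proof -
  let ?f = "\<lambda>\<theta>. \<Sum>\<mu>\<in>#nonzero_eigenvalues (Tr (spectral_part (\<eta> \<cdot>\<^sub>m P) \<theta>)).
     \<bar>Re \<mu> - nim (Re \<theta>) (Re \<mu>)\<bar> * log 2 (Re \<mu> / (Re \<theta> * real (eigenspace_dim (\<eta> \<cdot>\<^sub>m P) \<theta>)))"
  have f0: "?f 0 = 0"
    using assms by (simp add: spectral_part_smult_0)
  have "(\<Sum>\<theta>\<in>spectrum (\<eta> \<cdot>\<^sub>m P). ?f \<theta>) = ?f \<eta>"
  proof (cases "\<eta> \<in> spectrum (\<eta> \<cdot>\<^sub>m P)")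
    case True
    have "(\<Sum>\<theta>\<in>spectrum (\<eta> \<cdot>\<^sub>m P). ?f \<theta>) = (\<Sum>\<theta>\<in>{\<eta>}. ?f \<theta>)"
      by (rule sum.mono_neutral_right)
         (use True spectrum_smult[of \<eta>] f0 finite_subset in auto)
    thus ?thesis by simp
  next
    \<comment> \<open>Here \<open>P\<close> vanishes, so the spectrum lacks \<eta>, but the term for
      \<eta> is an empty sum as well.\<close>
    case False
    have "\<eta> \<cdot>\<^sub>m P = 0\<^sub>m n n"
      using zero_if_not_in_spectrum[OF False] by simp
    hence "?f \<eta> = 0"
      using spectral_part_smult[OF assms(1)] Tr0 by simp
    moreover have "(\<Sum>\<theta>\<in>spectrum (\<eta> \<cdot>\<^sub>m P). ?f \<theta>) = 0"
      by (rule sum.neutral) (use False spectrum_smult[of \<eta>] f0 in auto)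
    ultimately show ?thesis by simp
  qed
  thus ?thesis
    by (simp only: M_part_def spectral_part_smult[OF assms(1)])
qed


text \<open>Since \<open>P\<close> is idempotent and self-adjoint, the quadratic form at
  \<open>v\<close> is the squared norm of \<open>P *\<^sub>v v\<close>.\<close>

lemma positive_semidefinite_smult:
  assumes "0 \<le> \<eta>"
  shows "positive_semidefinite n (complex_of_real \<eta> \<cdot>\<^sub>m P)"
  unfolding positive_semidefinite_def
proof
  fix v :: "complex vec" assume v: "v \<in> carrier_vec n"
  have Pv: "P *\<^sub>v v \<in> carrier_vec n" using mult_mat_vec_carrier[OF carrier v] .
  have "(P *\<^sub>v v) \<bullet>c v = (P *\<^sub>v (P *\<^sub>v v)) \<bullet>c v" using v by (simp add: idem_vec)
  also have "\<dots> = (P *\<^sub>v v) \<bullet>c (mat_adjoint P *\<^sub>v v)"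
    by (rule cscalar_prod_adjoint[OF carrier Pv v])
  also have "\<dots> = (P *\<^sub>v v) \<bullet>c (P *\<^sub>v v)" by (simp add: adjoint)
  finally have "0 \<le> (P *\<^sub>v v) \<bullet>c v" by (simp add: conjugate_square_ge_0_vec)
  hence "0 \<le> Re ((P *\<^sub>v v) \<bullet>c v)" by (simp add: less_eq_complex_def)
  moreover have "((complex_of_real \<eta> \<cdot>\<^sub>m P) *\<^sub>v v) \<bullet>c v = complex_of_real \<eta> * ((P *\<^sub>v v) \<bullet>c v)"
    using v Pv by (simp add: smult_mult_vec)
  ultimately show "0 \<le> Re (((complex_of_real \<eta> \<cdot>\<^sub>m P) *\<^sub>v v) \<bullet>c v)"
    using assms by simp
qed

lemma density_matrix_smult:
  assumes "0 \<le> \<eta>" "mat_trace (complex_of_real \<eta> \<cdot>\<^sub>m P) = 1"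
  shows "density_matrix n (complex_of_real \<eta> \<cdot>\<^sub>m P)"
proof -
  have "conjugate (P $$ (j, i)) = P $$ (i, j)" if "i < n" "j < n" for i j
    using mat_adjoint_index[of i P j] that by (simp add: adjoint)
  hence "hermitian (complex_of_real \<eta> \<cdot>\<^sub>m P)"
    unfolding hermitian_def by (intro eq_matI) auto
  thus ?thesis
    using assms positive_semidefinite_smult by (simp add: density_matrix_def)
qed

end

section \<open>Block projectors\<close>

text \<open>
  \<open>k\<close> labels the blocks: this is the sum over all labels of the rank-one operators \<open>|u\<^sub>c><u\<^sub>c|\<close>, where
  \<open>u\<^sub>c\<close> is the restriction of \<open>u\<close> to the indices labelled \<open>c\<close>. Pure states (one label), identity
  matrices (injective labels), and their reindexed tensor products are all of this form.
\<close>

definition block_projector :: "nat \<Rightarrow> (nat \<Rightarrow> real) \<Rightarrow> (nat \<Rightarrow> 'k) \<Rightarrow> complex mat" where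
  "block_projector n u k =
     mat n n (\<lambda>(i, j). if k i = k j then complex_of_real (u i * u j) else 0)"

text \<open>Each block vector whose label occurs below \<open>n\<close> has norm one. Blocks with
  different labels have disjoint supports and are orthogonal anyway.\<close>

definition block_normalized :: "nat \<Rightarrow> (nat \<Rightarrow> real) \<Rightarrow> (nat \<Rightarrow> 'k) \<Rightarrow> bool" where
  "block_normalized n u k \<longleftrightarrow> (\<forall>i<n. (\<Sum>l<n. if k l = k i then (u l)\<^sup>2 else 0) = 1)"

lemma block_projector_carrier [simp]: "block_projector n u k \<in> carrier_mat n n"
  and block_projector_dim [simp]: "dim_row (block_projector n u k) = n" "dim_col (block_projector n u k) = n"
  by (simp_all add: block_projector_def)

lemma block_projector_index [simp]:
  "i < n \<Longrightarrow> j < n \<Longrightarrow>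
     block_projector n u k $$ (i, j) = (if k i = k j then complex_of_real (u i * u j) else 0)"
  by (simp add: block_projector_def)

text \<open>In the product of the matrix with itself, entry \<open>(i, j)\<close> factors into the
  original entry times the squared norm of the block of \<open>i\<close>, which is 1.\<close>

lemma projector_block_projector:
  assumes "block_normalized n u k"
  shows "projector n (block_projector n u k)"
proof
  show "hermitian (block_projector n u k)"
    unfolding hermitian_def by (rule eq_matI) auto
  show "block_projector n u k * block_projector n u k = block_projector n u k"
  proof (rule eq_matI)
    fix i j assume "i < dim_row (block_projector n u k)" "j < dim_col (block_projector n u k)"
    hence ij: "i < n" "j < n" by auto
    have "(block_projector n u k * block_projector n u k) $$ (i, j) =
        (\<Sum>l<n. block_projector n u k $$ (i, l) * block_projector n u k $$ (l, j))"
      using ij by (simp add: scalar_prod_def atLeast0LessThan)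
    also have "\<dots> = (\<Sum>l<n. block_projector n u k $$ (i, j) *
        complex_of_real (if k l = k i then (u l)\<^sup>2 else 0))"
      using ij by (intro sum.cong) (auto simp: power2_eq_square)
    also have "\<dots> = block_projector n u k $$ (i, j)"
      using assms ij
      by (simp only: sum_distrib_left[symmetric] of_real_sum[symmetric] block_normalized_def) simp
    finally show "(block_projector n u k * block_projector n u k) $$ (i, j) =
        block_projector n u k $$ (i, j)" .
  qed auto
qed simp

text \<open>The fixed space of a rank-one projector is the line through its vector. This supplies
  the multiplicity in the logarithm for pure states; for the mixed states below, vanishing weights
  settle the logarithmic terms.\<close>

lemma eigenspace_dim_pure:
  fixes u :: "nat \<Rightarrow> real" and c :: 'k
  assumes "(\<Sum>l<n. (u l)\<^sup>2) = 1"
  shows "eigenspace_dim (block_projector n u (\<lambda>_. c)) 1 = 1"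
proof -
  define P where "P = block_projector n u (\<lambda>_. c)"
  have norm: "block_normalized n u (\<lambda>_. c)" using assms by (simp add: block_normalized_def)
  interpret projector n P unfolding P_def by (rule projector_block_projector[OF norm])
  interpret K: kernel n n "char_matrix P 1" by unfold_locales simp
  have ker: "mat_kernel (char_matrix P 1) = {v \<in> carrier_vec n. P *\<^sub>v v = v}"
    using eigenspace_eq[OF carrier, of 1] by (simp add: eigenspace_def)
  define w where "w = vec n (\<lambda>i. complex_of_real (u i))"
  \<comment> \<open>The image of \<open>v\<close> is the inner product of \<open>u\<close> with
    \<open>v\<close>, times \<open>w\<close>; so a fixed vector is a multiple of
    \<open>w\<close>.\<close>
  have mult: "P *\<^sub>v v = (\<Sum>j<n. complex_of_real (u j) * v $ j) \<cdot>\<^sub>v w" if "v \<in> carrier_vec n" for v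
    using that
    by (intro eq_vecI)
       (auto simp: P_def w_def scalar_prod_def atLeast0LessThan sum_distrib_right sum_distrib_left intro!: sum.cong)
  have "(\<Sum>j<n. complex_of_real (u j) * w $ j) = complex_of_real (\<Sum>l<n. (u l)\<^sup>2)"
    unfolding of_real_sum by (intro sum.cong) (auto simp: w_def power2_eq_square)
  hence "P *\<^sub>v w = w" using mult[of w] assms by (simp add: w_def)
  hence w: "w \<in> mat_kernel (char_matrix P 1)" by (simp add: ker w_def)
  have "w \<noteq> 0\<^sub>v n"
  proof
    assume "w = 0\<^sub>v n"
    hence "u i = 0" if "i < n" for i using that by (auto simp: w_def vec_eq_iff)
    thus False using assms by simp
  qed
  moreover have "K.span {w} = mat_kernel (char_matrix P 1)"
  proof
    show "K.span {w} \<subseteq> mat_kernel (char_matrix P 1)"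
      using K.Ker.span_is_subset2[of "{w}"] w by simp
    show "mat_kernel (char_matrix P 1) \<subseteq> K.span {w}"
    proof
      fix v assume "v \<in> mat_kernel (char_matrix P 1)"
      hence v: "v \<in> carrier_vec n" "P *\<^sub>v v = v" by (auto simp: ker)
      define a where "a = (\<Sum>j<n. complex_of_real (u j) * v $ j)"
      have "v = a \<cdot>\<^sub>v w" using mult[OF v(1)] v(2) by (simp add: a_def)
      also have "\<dots> = K.lincomb (\<lambda>_. a) {w}"
      proof (rule eq_vecI)
        \<comment> \<open>Membership in the kernel is what gives the linear combination a known
          dimension.\<close>
        have "K.lincomb (\<lambda>_. a) {w} \<in> mat_kernel (char_matrix P 1)"
          using K.Ker.lincomb_closed[of "{w}" "\<lambda>_. a"] w by simp
        hence dim: "dim_vec (K.lincomb (\<lambda>_. a) {w}) = n" by (simp add: ker)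
        show "dim_vec (a \<cdot>\<^sub>v w) = dim_vec (K.lincomb (\<lambda>_. a) {w})"
          unfolding dim by (simp add: w_def)
        show "(a \<cdot>\<^sub>v w) $ i = K.lincomb (\<lambda>_. a) {w} $ i"
          if "i < dim_vec (K.lincomb (\<lambda>_. a) {w})" for i
          using that K.lincomb_index[of i "{w}" "\<lambda>_. a"] w unfolding dim by (simp add: w_def)
      qed
      finally show "v \<in> K.span {w}"
        unfolding K.Ker.span_def by (auto intro!: exI[of _ "{w}"])
    qed
  qed
  ultimately have "K.dim = 1"
    using w by (intro K.Ker.dim1I) auto
  thus ?thesis by (simp only: eigenspace_dim_def K.kernel_dim flip: P_def)
qed

section \<open>Eigenvalue sums of triangular and diagonal matrices\<close>

lemma nonzero_eigenvalues_upper_triangular: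
  assumes "A \<in> carrier_mat n n" "upper_triangular A"
  shows "nonzero_eigenvalues A = {#\<mu> \<in># mset (diag_mat A). \<mu> \<noteq> 0#}"
proof -
  \<comment> \<open>The roots of a product are the union of the roots of its factors provided that
    no factor is the zero polynomial.\<close>
  have "0 \<notin> set (map (\<lambda>a. [:- a, 1:]) (diag_mat A))" by auto
  hence "proots (char_poly A) = (\<Sum>a\<leftarrow>diag_mat A. {#a#})"
    unfolding char_poly_upper_triangular[OF assms]
    using proots_prod_list[of "map (\<lambda>a. [:- a, 1:]) (diag_mat A)"] by (auto simp: o_def)
  also have "\<dots> = mset (diag_mat A)" by (induction "diag_mat A") auto
  finally show ?thesis by (simp add: nonzero_eigenvalues_def)
qed

lemma sum_mset_filter_neutral:
  "(\<And>x. \<not> Q x \<Longrightarrow> f x = 0) \<Longrightarrow> (\<Sum>x\<in>#filter_mset Q X. f x) = (\<Sum>x\<in>#X. (f x :: real))"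
  by (induction X) auto

lemma nim_zero_right [simp]: "nim y 0 = 0"
  by (simp add: nim_def)

text \<open>Because \<open>f 0 = 0\<close>, the discarded zero eigenvalues may be put back, which
  leaves a sum over the diagonal. The summand of \<open>M_part\<close> satisfies this by
  \<open>nim_zero_right\<close>.\<close>

lemma sum_nonzero_eigenvalues_upper_triangular:
  fixes f :: "complex \<Rightarrow> real"
  assumes "A \<in> carrier_mat n n" "upper_triangular A" "f 0 = 0"
  shows "(\<Sum>\<mu>\<in>#nonzero_eigenvalues A. f \<mu>) = (\<Sum>i<n. f (A $$ (i, i)))"
proof -
  have "(\<Sum>\<mu>\<in>#nonzero_eigenvalues A. f \<mu>) = (\<Sum>\<mu>\<leftarrow>diag_mat A. f \<mu>)"
    unfolding nonzero_eigenvalues_upper_triangular[OF assms(1,2)]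
    using assms(3) by (subst sum_mset_filter_neutral) (auto simp flip: sum_mset_sum_list)
  also have "\<dots> = (\<Sum>i<n. f (A $$ (i, i)))"
    using assms(1) by (simp add: diag_mat_def o_def interv_sum_list_conv_sum_set_nat atLeast0LessThan)
  finally show ?thesis .
qed


text \<open>The working formula for every value of \<open>M\<close> below: all marginals that occur
  are diagonal in the standard basis.\<close>

lemma (in projector) M_part_smult_diagonal:
  assumes \<eta>: "\<eta> \<noteq> 0" and Tr0: "Tr (0\<^sub>m n n) = 0\<^sub>m m m"
    and T: "Tr (complex_of_real \<eta> \<cdot>\<^sub>m P) = mat m m (\<lambda>(i, j). if i = j then complex_of_real (t i) else 0)"
  shows "M_part Tr (complex_of_real \<eta> \<cdot>\<^sub>m P) =
    - (\<Sum>i<m. \<bar>t i - nim \<eta> (t i)\<bar> *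
         log 2 (t i / (\<eta> * real (eigenspace_dim (complex_of_real \<eta> \<cdot>\<^sub>m P) (complex_of_real \<eta>)))))"
proof -
  have "nonzero_eigenvalues (0\<^sub>m m m) = {#}"
    by (subst nonzero_eigenvalues_upper_triangular[of _ m])
       (auto simp: upper_triangular_def diag_mat_def)
  hence "nonzero_eigenvalues (Tr (0\<^sub>m n n)) = {#}" by (simp add: Tr0)
  moreover have "upper_triangular (Tr (complex_of_real \<eta> \<cdot>\<^sub>m P))"
    by (auto simp: T upper_triangular_def)
  ultimately show ?thesis
    using \<eta>
    by (subst M_part_smult)
       (auto simp: T sum_nonzero_eigenvalues_upper_triangular[of _ m])
qed

section \<open>Index arithmetic and tensor products of block projectors\<close>

lemma index_less: "a < n \<Longrightarrow> b < m \<Longrightarrow> a * m + b < n * (m :: nat)"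
proof -
  assume "a < n" "b < m"
  hence "a * m + b < Suc a * m" by simp
  also have "\<dots> \<le> n * m" using \<open>a < n\<close> by (intro mult_le_mono1) simp
  finally show ?thesis .
qed

lemma ptrace_zero:
  "ptrace_snd dA dB (0\<^sub>m (dA * dB) (dA * dB)) = 0\<^sub>m dA dA"
  "ptrace_fst dA dB (0\<^sub>m (dA * dB) (dA * dB)) = 0\<^sub>m dB dB"
  by (auto intro!: eq_matI simp: ptrace_snd_def ptrace_fst_def index_less)

text \<open>An entry of the tensor product survives exactly if the labels agree in both factors, so
  labels are paired while amplitudes and scalars multiply; reindexing composes both with
  \<open>f\<close>.\<close>

lemma reindex_tensor_block_projector:
  assumes "\<And>i. i < n * m \<Longrightarrow> f i < n * m"
  shows "reindex f (tensor_mat (complex_of_real a \<cdot>\<^sub>m block_projector n u k)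
             (complex_of_real b \<cdot>\<^sub>m block_projector m v l)) =
    complex_of_real (a * b) \<cdot>\<^sub>m block_projector (n * m) (\<lambda>i. u (f i div m) * v (f i mod m))
       (\<lambda>i. (k (f i div m), l (f i mod m)))"
proof (rule eq_matI, goal_cases)
  case (1 i j)
  hence ij: "i < n * m" "j < n * m" by auto
  hence "m > 0" by (cases m) auto
  hence "f i div m < n" "f j div m < n" "f i mod m < m" "f j mod m < m"
    using assms[OF ij(1)] assms[OF ij(2)] by (auto intro: less_mult_imp_div_less)
  thus ?case using ij assms[OF ij(1)] assms[OF ij(2)]
    by (auto simp: reindex_def tensor_mat_def)
qed (auto simp: reindex_def tensor_mat_def)

text \<open>Labels matter only through the partition they induce, so their type may be changed, for
  instance from pairs with a unit component to the other component.\<close>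

lemma block_projector_cong:
  assumes "\<And>i. i < n \<Longrightarrow> u i = v i"
    and "\<And>i j. i < n \<Longrightarrow> j < n \<Longrightarrow> k i = k j \<longleftrightarrow> l i = l j"
  shows "block_projector n u k = block_projector n v l"
  by (rule eq_matI) (use assms in auto)

section \<open>Pure states in Schmidt form\<close>

text \<open>The vector with Schmidt decomposition \<open>\<Sum>a. c a |a>|a>\<close>.\<close>

definition schmidt :: "nat \<Rightarrow> (nat \<Rightarrow> real) \<Rightarrow> nat \<Rightarrow> real" where
  "schmidt n c i = (if i div n = i mod n then c (i div n) else 0)"

definition schmidt_state :: "nat \<Rightarrow> (nat \<Rightarrow> real) \<Rightarrow> complex mat" where
  "schmidt_state n c = block_projector (n * n) (schmidt n c) (\<lambda>_. ())"

lemma schmidt_index [simp]: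
  "b < n \<Longrightarrow> schmidt n c (a * n + b) = (if a = b then c a else 0)"
  by (simp add: schmidt_def)

lemma sum_lessThan_mult:
  "(\<Sum>i<n * m. f i) = (\<Sum>a<n. \<Sum>b<m. f (a * m + b :: nat) :: 'a :: comm_monoid_add)"
proof -
  have "(\<Sum>b<m. f (a * m + b)) = sum f {a * m..<a * m + m}" for a
    using sum.shift_bounds_nat_ivl[of f 0 "a * m" m]
    by (simp add: atLeast0LessThan add.commute)
  thus ?thesis by (simp add: sum.nat_group)
qed

lemma sum_schmidt_square: "(\<Sum>i<n * n. (schmidt n c i)\<^sup>2) = (\<Sum>a<n. (c a)\<^sup>2)"
  by (auto simp: sum_lessThan_mult if_distrib[of "\<lambda>x. x\<^sup>2"] cong: if_cong)

lemma ptrace_schmidt_state: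
  "ptrace_snd n n (schmidt_state n c) = mat n n (\<lambda>(i, j). if i = j then complex_of_real ((c i)\<^sup>2) else 0)"
  "ptrace_fst n n (schmidt_state n c) = mat n n (\<lambda>(i, j). if i = j then complex_of_real ((c i)\<^sup>2) else 0)"
  by (auto intro!: eq_matI simp: ptrace_snd_def ptrace_fst_def schmidt_state_def index_less
        power2_eq_square if_distrib[of "\<lambda>x. x * _"] if_distrib[of "\<lambda>x. _ * x"] if_distrib[of complex_of_real] cong: if_cong)

lemma projector_schmidt_state:
  assumes "(\<Sum>a<n. (c a)\<^sup>2) = 1"
  shows "projector (n * n) (schmidt_state n c)"
  unfolding schmidt_state_def
  by (rule projector_block_projector) (simp add: block_normalized_def sum_schmidt_square assms)

lemma one_smult_mat [simp]: "(1 :: complex) \<cdot>\<^sub>m A = A"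
  by (rule eq_matI) auto

lemma density_matrix_schmidt_state:
  assumes "(\<Sum>a<n. (c a)\<^sup>2) = 1"
  shows "density_matrix (n * n) (schmidt_state n c)"
proof -
  have "mat_trace (schmidt_state n c) = complex_of_real (\<Sum>i<n * n. (schmidt n c i)\<^sup>2)"
    unfolding of_real_sum by (simp add: mat_trace_def schmidt_state_def power2_eq_square)
  thus ?thesis
    using projector.density_matrix_smult[OF projector_schmidt_state[OF assms], of 1]
    by (simp add: sum_schmidt_square assms)
qed

text \<open>Both marginals are the same diagonal matrix, so averaging the two parts changes nothing;
  the eigenvalue is 1 with multiplicity 1.\<close>

lemma M_schmidt_state:
  assumes "(\<Sum>a<n. (c a)\<^sup>2) = 1"
  shows "M n n (schmidt_state n c) = - (\<Sum>a<n. \<bar>(c a)\<^sup>2 - nim 1 ((c a)\<^sup>2)\<bar> * log 2 ((c a)\<^sup>2))"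
proof -
  interpret projector "n * n" "schmidt_state n c"
    by (rule projector_schmidt_state[OF assms])
  have dim: "eigenspace_dim (schmidt_state n c) 1 = 1"
    using eigenspace_dim_pure[where n = "n * n" and u = "schmidt n c" and c = "()"]
    by (simp add: schmidt_state_def sum_schmidt_square assms)
  show ?thesis
    using M_part_smult_diagonal[of 1 "ptrace_snd n n" n "\<lambda>i. (c i)\<^sup>2"]
      M_part_smult_diagonal[of 1 "ptrace_fst n n" n "\<lambda>i. (c i)\<^sup>2"]
    by (simp add: M_def M_A_def M_B_def dim ptrace_zero ptrace_schmidt_state)
qed


section \<open>Multiples under \<open>nim\<close>, and reordering the factors of two pairs of
  qubits\<close>

lemma nim_multiple:
  assumes "y \<noteq> 0"
  shows "nim y (y * of_int z) = y * of_int z"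
  using assms by (simp add: nim_def)

lemma projector_one: "projector n (1\<^sub>m n)"
  by unfold_locales (auto simp: hermitian_def intro!: eq_matI)

lemma ACBD_index_less:
  assumes "p < (dA * dC) * (dB * dD)"
  shows "ACBD_index dA dB dC dD p < (dA * dB) * (dC * dD)"
proof -
  define x y where "x = p div (dB * dD)" and "y = p mod (dB * dD)"
  have pos: "dB * dD > 0" using assms by (cases "dB * dD") auto
  have x: "x < dA * dC" unfolding x_def using assms by (rule less_mult_imp_div_less)
  have y: "y < dB * dD" unfolding y_def using pos by simp
  have "x mod dC < dC" "y mod dD < dD" using x y by (auto intro!: mod_less_divisor gr0I)
  moreover have "x div dC < dA" "y div dD < dB" using x y by (auto intro: less_mult_imp_div_less)
  ultimately show ?thesis
    unfolding ACBD_index_def Let_def x_def[symmetric] y_def[symmetric]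
    by (intro index_less)
qed

lemma sum_lessThan_2: "(\<Sum>i<(2::nat). f i) = f 0 + (f 1 :: 'a :: comm_monoid_add)"
  by (simp add: numeral_2_eq_2)

lemma sum_lessThan_4: "(\<Sum>i<(4::nat). f i) = f 0 + f 1 + f 2 + (f 3 :: 'a :: comm_monoid_add)"
  by (simp add: numeral_eq_Suc)

lemma less_4_cases: "(i :: nat) < 4 \<Longrightarrow> i = 0 \<or> i = 1 \<or> i = 2 \<or> i = 3"
  by auto

lemma less_16_cases:
  "(i :: nat) < 16 \<Longrightarrow> i = 0 \<or> i = 1 \<or> i = 2 \<or> i = 3 \<or> i = 4 \<or> i = 5 \<or> i = 6 \<or> i = 7 \<or>
     i = 8 \<or> i = 9 \<or> i = 10 \<or> i = 11 \<or> i = 12 \<or> i = 13 \<or> i = 14 \<or> i = 15"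
  by presburger

text \<open>A product of Schmidt vectors is again in Schmidt form for the cut between AC and BD,
  with products of coefficients. With all dimensions equal to 2, the 16 indices are checked one by
  one.\<close>

lemma reindex_tensor_schmidt_state:
  "reindex (ACBD_index 2 2 2 2) (tensor_mat (schmidt_state 2 c) (schmidt_state 2 d)) =
     schmidt_state 4 (\<lambda>i. c (i div 2) * d (i mod 2))"
proof -
  have "reindex (ACBD_index 2 2 2 2) (tensor_mat (schmidt_state 2 c) (schmidt_state 2 d)) =
      block_projector 16
        (\<lambda>i. schmidt 2 c (ACBD_index 2 2 2 2 i div 4) * schmidt 2 d (ACBD_index 2 2 2 2 i mod 4)) (\<lambda>i. ((), ()))"
    using reindex_tensor_block_projector[where n = 4 and m = 4 and f = "ACBD_index 2 2 2 2" and a = 1 and b = 1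
        and u = "schmidt 2 c" and v = "schmidt 2 d" and k = "\<lambda>_. ()" and l = "\<lambda>_. ()"]
      ACBD_index_less[of _ 2 2 2 2]
    by (simp add: schmidt_state_def)
  also have "\<dots> = block_projector 16 (schmidt 4 (\<lambda>i. c (i div 2) * d (i mod 2))) (\<lambda>_. ())"
  proof (rule block_projector_cong)
    fix i :: nat assume "i < 16"
    thus "schmidt 2 c (ACBD_index 2 2 2 2 i div 4) * schmidt 2 d (ACBD_index 2 2 2 2 i mod 4) =
       schmidt 4 (\<lambda>i. c (i div 2) * d (i mod 2)) i"
      using less_16_cases[OF \<open>i < 16\<close>]
      by (elim disjE) (simp_all add: ACBD_index_def Let_def schmidt_def)
  qed simp
  finally show ?thesis by (simp add: schmidt_state_def)
qed

lemma tensor_pow_2: "tensor_pow A 2 = tensor_mat A A"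
proof -
  have "tensor_mat A (1\<^sub>m 1) = A" by (rule eq_matI) (auto simp: tensor_mat_def)
  thus ?thesis by (simp add: numeral_2_eq_2)
qed

text \<open>For two copies of a pair of qubits both reorderings are the same permutation of 16
  indices, so the computation for the cut between AC and BD also decides weak additivity.\<close>

lemma M_copies_eq_M_AC_BD:
  assumes "A \<in> carrier_mat 4 4"
  shows "M_copies 2 2 2 (tensor_pow A 2) = M_AC_BD 2 2 2 2 (tensor_mat A A)"
proof -
  have "copies_index 2 2 2 i = ACBD_index 2 2 2 2 i" if "i < 16" for i
    using less_16_cases[OF that]
    by (elim disjE) (simp_all add: ACBD_index_def copies_index_def Let_def sum_lessThan_2)
  hence "reindex (copies_index 2 2 2) (tensor_mat A A) = reindex (ACBD_index 2 2 2 2) (tensor_mat A A)"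
    using assms by (auto intro!: eq_matI simp: reindex_def tensor_mat_def)
  thus ?thesis by (simp add: M_copies_def M_AC_BD_def tensor_pow_2)
qed


section \<open>The maximally mixed state, alone and next to a Bell state\<close>

text \<open>The marginal eigenvalues \<open>1 / 2\<close> are twice the eigenvalue
  \<open>1 / 4\<close> of the state, so every weight is zero.\<close>

lemma M_maximally_mixed: "M 2 2 (complex_of_real (1 / 4) \<cdot>\<^sub>m 1\<^sub>m 4) = 0"
proof -
  interpret projector 4 "1\<^sub>m 4" by (rule projector_one)
  have "nim (1 / 4) (1 / 2) = 1 / 2"
    using nim_multiple[of "1 / 4" 2] by simp
  moreover have
    "ptrace_snd 2 2 (complex_of_real (1 / 4) \<cdot>\<^sub>m 1\<^sub>m 4) = mat 2 2 (\<lambda>(i, j). if i = j then complex_of_real (1 / 2) else 0)"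
    "ptrace_fst 2 2 (complex_of_real (1 / 4) \<cdot>\<^sub>m 1\<^sub>m 4) = mat 2 2 (\<lambda>(i, j). if i = j then complex_of_real (1 / 2) else 0)"
    by (rule eq_matI; auto simp: ptrace_snd_def ptrace_fst_def less_Suc_eq numeral_2_eq_2)+
  ultimately show ?thesis
    using M_part_smult_diagonal[of "1 / 4" "ptrace_snd 2 2" 2 "\<lambda>_. 1 / 2"]
      M_part_smult_diagonal[of "1 / 4" "ptrace_fst 2 2" 2 "\<lambda>_. 1 / 2"]
      ptrace_zero[of 2 2]
    by (simp add: M_def M_A_def M_B_def)
qed

lemma density_matrix_maximally_mixed:
  "density_matrix 4 (complex_of_real (1 / 4) \<cdot>\<^sub>m 1\<^sub>m 4)"
  by (rule projector.density_matrix_smult[OF projector_one]) (simp_all add: mat_trace_def)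

lemma M_Bell_tensor_maximally_mixed:
  assumes h: "h * h = 1 / 2"
  shows "M_AC_BD 2 2 2 2 (tensor_mat (schmidt_state 2 (\<lambda>_. h)) (complex_of_real (1 / 4) \<cdot>\<^sub>m 1\<^sub>m 4)) = 0"
proof -
  \<comment> \<open>\<open>u\<close> is the Bell amplitude at the AB part of the original index, and
    \<open>k\<close> is the CD part, which serves as block label.\<close>
  define u where "u i = schmidt 2 (\<lambda>_. h) (ACBD_index 2 2 2 2 i div 4)" for i
  define k where "k i = ACBD_index 2 2 2 2 i mod 4" for i
  let ?P = "block_projector 16 u k"
  let ?\<tau> = "complex_of_real (1 / 4) \<cdot>\<^sub>m ?P"
  \<comment> \<open>Injective labels give blocks of size one, hence the identity.\<close>
  have one: "1\<^sub>m 4 = block_projector 4 (\<lambda>_. 1) (\<lambda>i. i)"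
    by (rule eq_matI) auto
  have "reindex (ACBD_index 2 2 2 2)
      (tensor_mat (schmidt_state 2 (\<lambda>_. h)) (complex_of_real (1 / 4) \<cdot>\<^sub>m 1\<^sub>m 4)) =
      complex_of_real (1 / 4) \<cdot>\<^sub>m block_projector 16 u (\<lambda>i. ((), k i))"
    using reindex_tensor_block_projector[where n = 4 and m = 4 and f = "ACBD_index 2 2 2 2" and a = 1 and b = "1 / 4"
        and u = "schmidt 2 (\<lambda>_. h)" and v = "\<lambda>_. 1" and k = "\<lambda>_. ()" and l = "\<lambda>i. i"]
      ACBD_index_less[of _ 2 2 2 2]
    by (simp add: schmidt_state_def one u_def[abs_def] k_def[abs_def])
  also have "block_projector 16 u (\<lambda>i. ((), k i)) = ?P"
    by (rule block_projector_cong) auto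
  finally have \<tau>: "reindex (ACBD_index 2 2 2 2)
      (tensor_mat (schmidt_state 2 (\<lambda>_. h)) (complex_of_real (1 / 4) \<cdot>\<^sub>m 1\<^sub>m 4)) = ?\<tau>" .
  \<comment> \<open>In the new order \<open>a\<close> encodes the digits of A and C, and
    \<open>b\<close> those of B and D: quotients by 2 belong to the Bell pair, remainders to the
    maximally mixed pair.\<close>
  have u: "u (a * 4 + b) = (if a div 2 = b div 2 then h else 0)"
    and k: "k (a * 4 + b) = (a mod 2) * 2 + b mod 2" if "a < 4" "b < 4" for a b
    using less_4_cases[OF that(1)] less_4_cases[OF that(2)]
    by (elim disjE; simp add: u_def k_def ACBD_index_def Let_def schmidt_def)+
  \<comment> \<open>For each label exactly two indices carry a nonzero Bell amplitude, and each has
    square \<open>1 / 2\<close>.\<close>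
  have "(\<Sum>l<16. if k l = k i then (u l)\<^sup>2 else 0) = 1" for i
  proof -
    have "k i < 4" by (simp add: k_def)
    have "(\<Sum>l<16. if k l = k i then (u l)\<^sup>2 else 0) =
        (\<Sum>a<4. \<Sum>b<4. if (a mod 2) * 2 + b mod 2 = k i then if a div 2 = b div 2 then 1 / 2 else 0 else (0 :: real))"
      using sum_lessThan_mult[of "\<lambda>l. if k l = k i then (u l)\<^sup>2 else 0" 4 4]
      by (simp add: u k h power2_eq_square if_distrib[of "\<lambda>x. x * x"] cong: if_cong)
    also have "\<dots> = 1"
      using less_4_cases[OF \<open>k i < 4\<close>]
      by (elim disjE) (simp_all add: sum_lessThan_4)
    finally show ?thesis .
  qed
  hence "block_normalized 16 u k" by (simp add: block_normalized_def)
  then interpret projector 16 ?P by (rule projector_block_projector)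
  have "ptrace_snd 4 4 ?\<tau> = mat 4 4 (\<lambda>(i, j). if i = j then complex_of_real (1 / 4) else 0)"
  proof (rule eq_matI, goal_cases)
    case (1 i j)
    hence ij: "i < 4" "j < 4" by auto
    \<comment> \<open>On the diagonal two values of \<open>b\<close> survive, each contributing
      \<open>1 / 4 * (h * h) = 1 / 8\<close>. Off the diagonal either the labels or the Bell digits
      disagree.\<close>
    have "ptrace_snd 4 4 ?\<tau> $$ (i, j) = complex_of_real (\<Sum>b<4. 1 / 4 *
        (if (i mod 2) * 2 + b mod 2 = (j mod 2) * 2 + b mod 2 then
           (if i div 2 = b div 2 then h else 0) * (if j div 2 = b div 2 then h else 0) else 0))"
      unfolding of_real_sum
      using ij index_less[of _ 4 _ 4] by (auto simp: ptrace_snd_def u k intro!: sum.cong)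
    also have "\<dots> = (if i = j then complex_of_real (1 / 4) else 0)"
      using less_4_cases[OF ij(1)] less_4_cases[OF ij(2)]
      by (elim disjE) (simp_all add: sum_lessThan_4 h)
    finally show ?case using ij by simp
  qed (simp_all add: ptrace_snd_def)
  moreover have "ptrace_fst 4 4 ?\<tau> = mat 4 4 (\<lambda>(i, j). if i = j then complex_of_real (1 / 4) else 0)"
  proof (rule eq_matI, goal_cases)
    case (1 i j)
    hence ij: "i < 4" "j < 4" by auto
    have "ptrace_fst 4 4 ?\<tau> $$ (i, j) = complex_of_real (\<Sum>a<4. 1 / 4 *
        (if (a mod 2) * 2 + i mod 2 = (a mod 2) * 2 + j mod 2 then
           (if a div 2 = i div 2 then h else 0) * (if a div 2 = j div 2 then h else 0) else 0))"
      unfolding of_real_sum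
      using ij index_less[of _ 4 _ 4] by (auto simp: ptrace_fst_def u k intro!: sum.cong)
    also have "\<dots> = (if i = j then complex_of_real (1 / 4) else 0)"
      using less_4_cases[OF ij(1)] less_4_cases[OF ij(2)]
      by (elim disjE) (simp_all add: sum_lessThan_4 h)
    finally show ?case using ij by simp
  qed (simp_all add: ptrace_fst_def)
  moreover have "nim (1 / 4) (1 / 4) = 1 / 4"
    using nim_multiple[of "1 / 4" 1] by simp
  ultimately show ?thesis
    using M_part_smult_diagonal[of "1 / 4" "ptrace_snd 4 4" 4 "\<lambda>_. 1 / 4"]
      M_part_smult_diagonal[of "1 / 4" "ptrace_fst 4 4" 4 "\<lambda>_. 1 / 4"] ptrace_zero[of 4 4]
    by (simp add: M_AC_BD_def M_def M_A_def M_B_def \<tau>[simplified])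
qed

section \<open>Rounding to integers, and the values for pure states\<close>

text \<open>The tie at \<open>1 / 2\<close> is included since ties round down; the Bell state uses
  exactly this case.\<close>

lemma nim_1_eq_0: "0 \<le> x \<Longrightarrow> x \<le> 1 / 2 \<Longrightarrow> nim 1 x = 0"
proof -
  assume x: "0 \<le> x" "x \<le> 1 / 2"
  hence "\<lfloor>x\<rfloor> = 0" by linarith
  moreover have "x = 0 \<or> \<lceil>x\<rceil> = 1" using x by linarith
  ultimately show ?thesis using x by (auto simp: nim_def)
qed

lemma nim_1_eq_1: "1 / 2 < x \<Longrightarrow> x \<le> 1 \<Longrightarrow> nim 1 x = 1"
proof -
  assume x: "1 / 2 < x" "x \<le> 1"
  hence "\<lceil>x\<rceil> = 1" by linarith
  moreover have "x = 1 \<or> \<lfloor>x\<rfloor> = 0" using x by linarith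
  ultimately show ?thesis using x by (auto simp: nim_def)
qed

lemma M_Bell:
  assumes h: "h * h = 1 / 2"
  shows "M 2 2 (schmidt_state 2 (\<lambda>_. h)) = 1"
proof -
  have h2: "h\<^sup>2 = 1 / 2" using h by (simp add: power2_eq_square)
  have "log 2 (1 / 2) = (- 1 :: real)" by (simp add: log_divide)
  thus ?thesis by (subst M_schmidt_state) (simp_all add: h2 nim_1_eq_0)
qed

text \<open>For two copies no coefficient is rounded up, and the value is twice the Shannon entropy
  of the distribution \<open>9 / 25\<close>, \<open>16 / 25\<close>. A single copy gives the larger
  coefficient the reduced weight \<open>9 / 25\<close>, so the two sides differ by
  \<open>- 14 / 25 * log 2 q\<close>, which is positive.\<close>

lemma M_tensor_square_greater:
  fixes c :: "nat \<Rightarrow> real"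
  assumes c: "(c 0)\<^sup>2 = 9 / 25" "(c 1)\<^sup>2 = 16 / 25"
  shows "2 * M 2 2 (schmidt_state 2 c) <
    M_AC_BD 2 2 2 2 (tensor_mat (schmidt_state 2 c) (schmidt_state 2 c))"
proof -
  define p q :: real where "p = 9 / 25" and "q = 16 / 25"
  have pq: "0 < p" "0 < q" by (simp_all add: p_def q_def)
  \<comment> \<open>The coefficient \<open>q\<close> exceeds \<open>1 / 2\<close> and is rounded to
    1, so its weight is \<open>1 - q\<close>.\<close>
  have "M 2 2 (schmidt_state 2 c) = - (p * log 2 p + (1 - q) * log 2 q)"
    by (subst M_schmidt_state)
       (simp_all add: sum_lessThan_2 c nim_1_eq_0 nim_1_eq_1 p_def q_def del: One_nat_def)
  hence 1: "M 2 2 (schmidt_state 2 c) = - (9 / 25 * log 2 p + 9 / 25 * log 2 q)"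
    by (simp add: q_def p_def)
  have d: "(\<Sum>a<4. (c (a div 2) * c (a mod 2))\<^sup>2) = 1"
    unfolding power_mult_distrib by (simp add: sum_lessThan_4 c del: One_nat_def)
  have "M_AC_BD 2 2 2 2 (tensor_mat (schmidt_state 2 c) (schmidt_state 2 c)) =
      - (\<Sum>a<4. (c (a div 2) * c (a mod 2))\<^sup>2 * log 2 ((c (a div 2) * c (a mod 2))\<^sup>2))"
  proof -
    \<comment> \<open>The coefficients are \<open>81 / 625\<close>, \<open>144 / 625\<close> (twice)
      and \<open>256 / 625\<close>, all below \<open>1 / 2\<close>.\<close>
    have "nim 1 ((c (a div 2) * c (a mod 2))\<^sup>2) = 0" if "a < 4" for a
      using less_4_cases[OF that] unfolding power_mult_distrib
      by (elim disjE) (simp_all add: c nim_1_eq_0 del: One_nat_def)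
    thus ?thesis
      using M_schmidt_state[OF d]
      by (simp add: M_AC_BD_def reindex_tensor_schmidt_state)
  qed
  also have "\<dots> = - (p * p * log 2 (p * p) + 2 * (p * q) * log 2 (p * q) + q * q * log 2 (q * q))"
    unfolding power_mult_distrib by (simp add: sum_lessThan_4 c p_def q_def del: One_nat_def)
  \<comment> \<open>Splitting the logarithms and using \<open>p + q = 1\<close> leaves
    \<open>2 * p\<close> and \<open>2 * q\<close> as coefficients.\<close>
  also have "\<dots> = - (18 / 25 * log 2 p + 32 / 25 * log 2 q)"
    using pq by (simp add: log_mult) (simp add: p_def q_def algebra_simps)
  finally have 2: "M_AC_BD 2 2 2 2 (tensor_mat (schmidt_state 2 c) (schmidt_state 2 c)) =
     - (18 / 25 * log 2 p + 32 / 25 * log 2 q)" .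
  have "log 2 q < 0" by (simp add: q_def)
  thus ?thesis unfolding 1 2 by simp
qed

theorem proposition6:
  shows "\<not> (\<forall>dA dB dC dD \<rho> \<sigma>.
           density_matrix (dA * dB) \<rho> \<longrightarrow> density_matrix (dC * dD) \<sigma> \<longrightarrow>
           M_AC_BD dA dB dC dD (tensor_mat \<rho> \<sigma>) \<le> M dA dB \<rho> + M dC dD \<sigma>)
       \<and> \<not> (\<forall>dA dB dC dD \<rho> \<sigma>.
           density_matrix (dA * dB) \<rho> \<longrightarrow> density_matrix (dC * dD) \<sigma> \<longrightarrow>
           M_AC_BD dA dB dC dD (tensor_mat \<rho> \<sigma>) \<ge> M dA dB \<rho> + M dC dD \<sigma>)
       \<and> \<not> (\<forall>dA dB \<rho> m.
           density_matrix (dA * dB) \<rho> \<longrightarrow> 0 < m \<longrightarrow>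
           M_copies dA dB m (tensor_pow \<rho> m) = real m * M dA dB \<rho>)"
proof -
  \<comment> \<open>The choice needs squares summing to 1, the larger one above \<open>1 / 2\<close>
    with its own square below \<open>1 / 2\<close>; the triple 3, 4, 5 achieves this with rational
    amplitudes.\<close>
  define c :: "nat \<Rightarrow> real" where "c a = (if a = 0 then 3 / 5 else 4 / 5)" for a
  define \<rho> where "\<rho> = schmidt_state 2 c"
  have "(\<Sum>a<2. (c a)\<^sup>2) = 1" by (simp add: c_def sum_lessThan_2 power2_eq_square)
  hence \<rho>: "density_matrix (2 * 2) \<rho>"
    using density_matrix_schmidt_state[of c 2] by (simp add: \<rho>_def)
  have greater: "2 * M 2 2 \<rho> < M_AC_BD 2 2 2 2 (tensor_mat \<rho> \<rho>)"
    unfolding \<rho>_def by (rule M_tensor_square_greater) (simp_all add: c_def power2_eq_square)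
  define h :: real where "h = sqrt (1 / 2)"
  have h: "h * h = 1 / 2" unfolding h_def using real_sqrt_mult_self[of "1 / 2"] by simp
  define \<beta> where "\<beta> = schmidt_state 2 (\<lambda>_. h)"
  define \<sigma> where "\<sigma> = complex_of_real (1 / 4) \<cdot>\<^sub>m 1\<^sub>m 4"
  have \<beta>: "density_matrix (2 * 2) \<beta>"
    using density_matrix_schmidt_state[of "\<lambda>_. h" 2] h by (simp add: \<beta>_def power2_eq_square)
  have \<sigma>: "density_matrix (2 * 2) \<sigma>"
    using density_matrix_maximally_mixed by (simp add: \<sigma>_def)
  have less: "M_AC_BD 2 2 2 2 (tensor_mat \<beta> \<sigma>) < M 2 2 \<beta> + M 2 2 \<sigma>"
    unfolding \<beta>_def \<sigma>_def M_Bell[OF h] M_maximally_mixed M_Bell_tensor_maximally_mixed[OF h] by simp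
  have "M_copies 2 2 2 (tensor_pow \<rho> 2) = M_AC_BD 2 2 2 2 (tensor_mat \<rho> \<rho>)"
    by (rule M_copies_eq_M_AC_BD) (use \<rho> in \<open>simp add: density_matrix_def\<close>)
  hence copies: "M_copies 2 2 2 (tensor_pow \<rho> 2) \<noteq> real 2 * M 2 2 \<rho>"
    using greater by simp
  show ?thesis
  proof (intro conjI notI)
    assume "\<forall>dA dB dC dD \<rho> \<sigma>.
      density_matrix (dA * dB) \<rho> \<longrightarrow> density_matrix (dC * dD) \<sigma> \<longrightarrow>
      M_AC_BD dA dB dC dD (tensor_mat \<rho> \<sigma>) \<le> M dA dB \<rho> + M dC dD \<sigma>"
    \<comment> \<open>Both arguments are the same state, so the right-hand side becomes twice its
      value.\<close>
    from this[rule_format, OF \<rho> \<rho>] show False using greater by simp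
  next
    assume "\<forall>dA dB dC dD \<rho> \<sigma>.
      density_matrix (dA * dB) \<rho> \<longrightarrow> density_matrix (dC * dD) \<sigma> \<longrightarrow>
      M_AC_BD dA dB dC dD (tensor_mat \<rho> \<sigma>) \<ge> M dA dB \<rho> + M dC dD \<sigma>"
    from this[rule_format, OF \<beta> \<sigma>] show False using less by simp
  next
    assume "\<forall>dA dB \<rho> m. density_matrix (dA * dB) \<rho> \<longrightarrow> 0 < m \<longrightarrow>
      M_copies dA dB m (tensor_pow \<rho> m) = real m * M dA dB \<rho>"
    from this[rule_format, OF \<rho>, of 2] show False using copies by simp
  qed
qed

end
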